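(* Let $p:\mathbb{R}^n\to\mathbb{R}$ be a cubic polynomial with a second-order point. Then the following two sets are equal: \begin{itemize} \item[(i)] $SO_p$, the set of second-order points of $p$; \item[(ii)] the set of minima (optimal solutions) of the optimization problem $\inf_{x\in\mathbb{R}^n} p(x)$ subject to $\nabla^2 p(x)\succeq 0$. \end{itemize} Furthermore, if $p$ has a local minimum, then these two sets are equal to \begin{itemize} \item[(iii)] $\overline{LM_p}$, the closure of the set $LM_p$ of local minima of $p$. \end{itemize}
   Context: A cubic polynomial is a real polynomial all of whose monomials have degree at most 3. A second-order point of $p$ is a point $x$ with $\nabla p(x)=0$ and $\nabla^2 p(x)\succeq 0$ (positive semidefinite Hessian). A point $\bar x$ is a local minimum of $p$ if there is $\epsilon>0$ such that $p(\bar x)\le p(y)$ for all $y$ with $\|y-\bar x\|\le\epsilon$. *)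

theory Defs
  imports "HOL-Analysis.Analysis"
begin

definition partial_deriv :: "'n::finite \<Rightarrow> (real^'n \<Rightarrow> real) \<Rightarrow> real^'n \<Rightarrow> real" where
  "partial_deriv i f x = deriv (\<lambda>t. f (x + t *\<^sub>R axis i 1)) 0"

definition gradient :: "(real^'n \<Rightarrow> real) \<Rightarrow> real^'n \<Rightarrow> real^'n::finite" where
  "gradient f x = (\<chi> i. partial_deriv i f x)"

definition hessian :: "(real^'n \<Rightarrow> real) \<Rightarrow> real^'n \<Rightarrow> real^'n^'n::finite" where
  "hessian f x = (\<chi> i j. partial_deriv i (partial_deriv j f) x)"

definition pos_semidef :: "real^'n^'n::finite \<Rightarrow> bool" where
  "pos_semidef A \<longleftrightarrow> transpose A = A \<and> (\<forall>v. 0 \<le> v \<bullet> (A *v v))"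

text \<open>A monomial is given by its exponent vector \<open>\<alpha>\<close>; as the degree is only bounded by 3,
  affine and quadratic polynomials are included.\<close>

definition cubic_polynomial :: "(real^'n::finite \<Rightarrow> real) \<Rightarrow> bool" where
  "cubic_polynomial p \<longleftrightarrow>
     (\<exists>c :: ('n \<Rightarrow> nat) \<Rightarrow> real. \<forall>x.
        p x = (\<Sum>\<alpha> | (\<Sum>i\<in>UNIV. \<alpha> i) \<le> 3. c \<alpha> * (\<Prod>i\<in>UNIV. (x $ i) ^ \<alpha> i)))"

text \<open>The sum above ranges over a finite set, so it is not the default value 0.\<close>

lemma finite_exponents_degree_le: "finite {\<alpha> :: 'n::finite \<Rightarrow> nat. (\<Sum>i\<in>UNIV. \<alpha> i) \<le> d}"
proof (rule finite_subset)
  show "{\<alpha> :: 'n \<Rightarrow> nat. (\<Sum>i\<in>UNIV. \<alpha> i) \<le> d} \<subseteq> (UNIV \<rightarrow>\<^sub>E {..d})"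
  proof
    fix \<alpha> :: "'n \<Rightarrow> nat" assume a: "\<alpha> \<in> {\<alpha>. (\<Sum>i\<in>UNIV. \<alpha> i) \<le> d}"
    have "\<alpha> i \<le> (\<Sum>i\<in>UNIV. \<alpha> i)" for i
      by (rule member_le_sum) auto
    with a show "\<alpha> \<in> UNIV \<rightarrow>\<^sub>E {..d}"
      by (auto intro: order_trans)
  qed
  show "finite ((UNIV :: 'n set) \<rightarrow>\<^sub>E {..d})"
    by (rule finite_PiE) auto
qed

definition second_order_points :: "(real^'n::finite \<Rightarrow> real) \<Rightarrow> (real^'n) set" where
  "second_order_points p = {x. gradient p x = 0 \<and> pos_semidef (hessian p x)}"

definition local_minima :: "(real^'n::finite \<Rightarrow> real) \<Rightarrow> (real^'n) set" where
  "local_minima p = {x. \<exists>\<epsilon>>0. \<forall>y. norm (y - x) \<le> \<epsilon> \<longrightarrow> p x \<le> p y}"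

text \<open>Optimal solutions of minimising \<open>f\<close> over the feasible set \<open>S\<close>.\<close>

definition minimizers_on :: "('a \<Rightarrow> real) \<Rightarrow> 'a set \<Rightarrow> 'a set" where
  "minimizers_on f S = {x \<in> S. \<forall>y\<in>S. f x \<le> f y}"

end

theory Submission
  imports Defs
begin

text \<open>
  Write \<open>H\<close> for the Hessian, \<open>g\<close> for the gradient and \<open>M\<close> for the (constant) third derivative of \<open>p\<close>.
  If \<open>x\<close> is a second-order point and \<open>y = x + d\<close>, Taylor's formula reads
  \<open>p y = p x + d \<bullet> H x d / 3 + d \<bullet> H y d / 6\<close>. So \<open>x\<close> is optimal among the \<open>y\<close> with \<open>H y \<succeq> 0\<close>, and
  if such a \<open>y\<close> has the same value then \<open>H x d = 0 = H y d\<close>, whence \<open>g y = g x + (H x + H y) d / 2 = 0\<close>.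

  A second-order point \<open>x\<close> is a local minimum iff \<open>M w w = 0\<close> for every \<open>w\<close> in the kernel of \<open>H x\<close>.
  If \<open>x\<close> is a local minimum and \<open>y\<close> a second-order point, then every point of the half-open segment
  from \<open>x\<close> to \<open>y\<close> is second-order and its Hessian has a kernel inside that of \<open>H x\<close>. All these
  points are therefore local minima, and they accumulate at \<open>y\<close>.
\<close>

section \<open>One-variable cubics near 0 and positive semidefinite matrices\<close>

text \<open>An odd power of \<open>s\<close> changes sign at 0, so it cannot be the leading term; an
  even one needs a nonnegative coefficient. For \<open>p\<close> along a line this gives the first-,
  second- and third-order necessary conditions.\<close>

lemma cubic_nonneg_near_0:
  fixes a b c :: real
  assumes "\<forall>\<^sub>F s in nhds 0. 0 \<le> a * s + b * s^2 + c * s^3"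
  shows "a = 0" and "0 \<le> b" and "b = 0 \<Longrightarrow> c = 0"
proof -
  have odd: "k = 0" if ev: "\<forall>\<^sub>F s in nhds 0. 0 \<le> s * f s" and lim: "(f \<longlongrightarrow> k) (at 0)"
    for f and k :: real
  proof (rule antisym)
    have r: "\<forall>\<^sub>F s in at_right 0. 0 \<le> f s" and l: "\<forall>\<^sub>F s in at_left 0. f s \<le> 0"
      using ev unfolding eventually_at_filter
      by (auto elim!: eventually_mono simp: zero_le_mult_iff)
    have "(f \<longlongrightarrow> k) (at_right 0)" "(f \<longlongrightarrow> k) (at_left 0)"
      using lim by (simp_all add: filterlim_at_split)
    then show "k \<le> 0" "0 \<le> k"
      using tendsto_upperbound[OF _ l] tendsto_lowerbound[OF _ r] by auto
  qed
  show a: "a = 0"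
  proof (rule odd)
    show "\<forall>\<^sub>F s in nhds 0. 0 \<le> s * (a + b * s + c * s^2)"
      using assms by eventually_elim (simp add: algebra_simps power2_eq_square power3_eq_cube)
    show "((\<lambda>s. a + b * s + c * s^2) \<longlongrightarrow> a) (at 0)"
      by (auto intro!: tendsto_eq_intros)
  qed
  show "0 \<le> b"
  proof (rule tendsto_lowerbound)
    show "((\<lambda>s. b + c * s) \<longlongrightarrow> b) (at 0)"
      by (auto intro!: tendsto_eq_intros)
    have "0 \<le> b + c * s" if "s \<noteq> 0" "0 \<le> a * s + b * s^2 + c * s^3" for s
    proof -
      have "0 \<le> s^2 * (b + c * s)"
        using that a by (simp add: algebra_simps power2_eq_square power3_eq_cube)
      then show ?thesis
        using that by (simp add: zero_le_mult_iff)
    qed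
    then show "\<forall>\<^sub>F s in at 0. 0 \<le> b + c * s"
      using assms unfolding eventually_at_filter by (auto elim!: eventually_mono)
  qed simp
  show "c = 0" if b: "b = 0"
  proof (rule odd)
    have "0 \<le> s * c" if "0 \<le> a * s + b * s^2 + c * s^3" for s
    proof -
      have "0 \<le> s^2 * (s * c)"
        using that a b by (simp add: power2_eq_square power3_eq_cube mult_ac)
      then show ?thesis
        by (cases "s = 0") (simp_all add: zero_le_mult_iff)
    qed
    then show "\<forall>\<^sub>F s in nhds 0. 0 \<le> s * c"
      using assms by (auto elim!: eventually_mono)
  qed simp
qed

lemma symmetric_matrix_inner:
  fixes A :: "real^'n::finite^'n"
  assumes "transpose A = A"
  shows "u \<bullet> (A *v v) = v \<bullet> (A *v u)"
  by (metis assms dot_lmul_matrix inner_commute transpose_matrix_vector)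

text \<open>Along the line \<open>v + s *\<^sub>R (A *v v)\<close> the quadratic form is a
  nonnegative polynomial in \<open>s\<close> without constant term, so its linear coefficient, twice
  the squared norm of \<open>A *v v\<close>, is zero.\<close>

lemma pos_semidef_kernel:
  fixes A :: "real^'n::finite^'n"
  assumes A: "pos_semidef A" and v: "v \<bullet> (A *v v) = 0"
  shows "A *v v = 0"
proof -
  let ?y = "A *v v"
  have sym: "transpose A = A"
    using A by (simp add: pos_semidef_def)
  have "(v + s *\<^sub>R ?y) \<bullet> (A *v (v + s *\<^sub>R ?y))
      = (2 * (?y \<bullet> ?y)) * s + (?y \<bullet> (A *v ?y)) * s^2 + 0 * s^3" for s
    using v symmetric_matrix_inner[OF sym, of v ?y]
    by (simp add: matrix_vector_right_distrib matrix_vector_mult_scaleR inner_simps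
        power2_eq_square algebra_simps)
  moreover have "0 \<le> (v + s *\<^sub>R ?y) \<bullet> (A *v (v + s *\<^sub>R ?y))" for s
    using A by (simp add: pos_semidef_def)
  ultimately have "\<forall>\<^sub>F s in nhds 0.
      0 \<le> (2 * (?y \<bullet> ?y)) * s + (?y \<bullet> (A *v ?y)) * s^2 + 0 * s^3"
    by (metis (no_types, lifting) always_eventually)
  from cubic_nonneg_near_0(1)[OF this] show ?thesis
    by simp
qed

text \<open>The form is positive on the compact unit sphere of the orthogonal complement of the
  kernel, hence bounded below there by some \<open>l > 0\<close>; scaling extends the bound.\<close>

lemma pos_semidef_coercive:
  fixes A :: "real^'n::finite^'n"
  assumes A: "pos_semidef A"
  obtains l where "l > 0"
    "\<And>u. (\<And>w. A *v w = 0 \<Longrightarrow> orthogonal u w) \<Longrightarrow> l * (norm u)^2 \<le> u \<bullet> (A *v u)"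
proof -
  define S where "S = {u. norm u = 1 \<and> (\<forall>w. A *v w = 0 \<longrightarrow> orthogonal u w)}"
  have S_eq: "S = sphere 0 1 \<inter> (\<Inter>w\<in>{w. A *v w = 0}. {u. u \<bullet> w = 0})"
    by (auto simp: S_def orthogonal_def dist_norm)
  have "compact S"
    unfolding S_eq
    by (intro compact_Int_closed compact_sphere closed_INT ballI closed_Collect_eq
        continuous_intros)
  have pos: "0 < u \<bullet> (A *v u)" if "u \<in> S" for u
  proof -
    have "0 \<le> u \<bullet> (A *v u)"
      using A by (simp add: pos_semidef_def)
    \<comment> \<open>Otherwise \<open>u\<close> would lie in the kernel and be orthogonal to
      itself, although it has norm 1.\<close>
    moreover have "u \<bullet> (A *v u) \<noteq> 0"
      using that pos_semidef_kernel[OF A, of u] by (auto simp: S_def orthogonal_def)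
    ultimately show ?thesis
      by linarith
  qed
  have "\<exists>l>0. \<forall>u\<in>S. l \<le> u \<bullet> (A *v u)"
  proof (cases "S = {}")
    case True
    then show ?thesis
      by (auto intro: exI[of _ 1])
  next
    case False
    have "continuous_on S (\<lambda>u. u \<bullet> (A *v u))"
      by (intro continuous_intros matrix_vector_mult_linear_continuous_on)
    from continuous_attains_inf[OF \<open>compact S\<close> False this] pos show ?thesis
      by blast
  qed
  then obtain l where l: "l > 0" "\<And>u. u \<in> S \<Longrightarrow> l \<le> u \<bullet> (A *v u)"
    by blast
  show ?thesis
  proof (rule that[OF l(1)])
    fix u assume orth: "\<And>w. A *v w = 0 \<Longrightarrow> orthogonal u w"
    show "l * (norm u)^2 \<le> u \<bullet> (A *v u)"
    proof (cases "u = 0")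
      case False
      let ?e = "u /\<^sub>R norm u"
      have "?e \<in> S"
        using orth False by (auto simp: S_def orthogonal_def)
      then have "l \<le> ?e \<bullet> (A *v ?e)"
        by (rule l(2))
      also have "\<dots> = u \<bullet> (A *v u) / (norm u)^2"
        by (simp add: matrix_vector_mult_scaleR power2_eq_square divide_simps)
      finally show ?thesis
        using False by (simp add: pos_le_divide_eq)
    qed simp
  qed
qed

section \<open>Exact Taylor calculus of a cubic\<close>

text \<open>The map \<open>M\<close> encodes a trilinear form: \<open>M_sym\<close> and
  \<open>M_commute\<close> together make \<open>u \<bullet> (M x *v v)\<close> symmetric in all
  three arguments. With the factors 1/2 and 1/6, \<open>B\<close> is the Hessian at 0 and
  \<open>M\<close> the third derivative.\<close>

locale cubic_expansion =
  fixes p :: "real^'n::finite \<Rightarrow> real"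
    and c :: real and b :: "real^'n" and B :: "real^'n^'n" and M :: "real^'n \<Rightarrow> real^'n^'n"
  assumes lin: "linear M"
    and B_sym: "transpose B = B"
    and M_sym: "\<And>x. transpose (M x) = M x"
    and M_commute: "\<And>x y. M x *v y = M y *v x"
    and p_eq: "\<And>x. p x = c + b \<bullet> x + x \<bullet> (B *v x) / 2 + x \<bullet> (M x *v x) / 6"
begin

definition g :: "real^'n \<Rightarrow> real^'n" where
  "g x = b + B *v x + (1/2) *\<^sub>R (M x *v x)"

definition H :: "real^'n \<Rightarrow> real^'n^'n" where
  "H x = B + M x"

lemma M_inner: "u \<bullet> (M x *v v) = v \<bullet> (M x *v u)"
  by (rule symmetric_matrix_inner[OF M_sym])

lemma M_inner': "u \<bullet> (M x *v v) = x \<bullet> (M u *v v)"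
  by (metis M_inner M_commute)

lemmas M_linear = linear_add[OF lin] linear_scale[OF lin] linear_0[OF lin] linear_diff[OF lin]

lemmas mat_simps = matrix_vector_mult_add_rdistrib matrix_vector_right_distrib
  matrix_vector_mult_scaleR scaleR_matrix_vector_assoc[symmetric]

lemma M_bilinear: "bilinear (\<lambda>x y. M x *v y)"
  unfolding bilinear_def
  by (auto intro!: linearI simp: M_linear mat_simps)

lemma H_sym: "transpose (H x) = H x"
  using B_sym M_sym by (simp add: H_def transpose_def vec_eq_iff)

lemma H_add: "H (x + d) = H x + M d"
  by (simp add: H_def M_linear)

lemma g_add: "g (x + d) = g x + H x *v d + (1/2) *\<^sub>R (M d *v d)"
  unfolding g_def H_def M_linear mat_simps M_commute[of d x]
  by (simp add: vec_eq_iff add_divide_distrib)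

lemma p_add: "p (x + d) = p x + g x \<bullet> d + d \<bullet> (H x *v d) / 2 + d \<bullet> (M d *v d) / 6"
proof -
  have g: "g x \<bullet> d = b \<bullet> d + d \<bullet> (B *v x) + d \<bullet> (M x *v x) / 2"
    unfolding g_def by (subst inner_commute) (simp add: inner_add_right inner_commute[of d b])
  have H: "d \<bullet> (H x *v d) = d \<bullet> (B *v d) + d \<bullet> (M x *v d)"
    unfolding H_def mat_simps inner_add_right ..
  have B: "(x + d) \<bullet> (B *v (x + d)) = x \<bullet> (B *v x) + 2 * (d \<bullet> (B *v x)) + d \<bullet> (B *v d)"
    unfolding mat_simps inner_add_right inner_add_left
    using symmetric_matrix_inner[OF B_sym, of x d] by linarith
  have "(x + d) \<bullet> (M (x + d) *v (x + d))
      = x \<bullet> (M x *v x) + x \<bullet> (M x *v d) + x \<bullet> (M d *v x) + x \<bullet> (M d *v d)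
      + (d \<bullet> (M x *v x) + d \<bullet> (M x *v d) + d \<bullet> (M d *v x) + d \<bullet> (M d *v d))"
    unfolding M_linear mat_simps inner_add_right inner_add_left by linarith
  \<comment> \<open>Symmetry of the trilinear form collects the eight terms with binomial weights 1,
    3, 3, 1.\<close>
  also have "\<dots> = x \<bullet> (M x *v x) + 3 * (d \<bullet> (M x *v x)) + 3 * (d \<bullet> (M x *v d))
      + d \<bullet> (M d *v d)"
    unfolding M_commute[of d x] M_inner[of x x d] M_inner'[of x d d] by linarith
  finally show ?thesis
    unfolding p_eq[of "x + d"] p_eq[of x] B g H inner_add_right by (simp add: field_simps)
qed

lemma partial_deriv_p: "partial_deriv i p x = g x $ i"
proof -
  let ?e = "axis i 1 :: real^'n"
  have "((\<lambda>t. p (x + t *\<^sub>R ?e)) has_field_derivative g x \<bullet> ?e) (at 0)"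
    unfolding p_add
    by (auto simp: M_linear mat_simps intro!: derivative_eq_intros)
  then show ?thesis
    by (simp add: partial_deriv_def DERIV_imp_deriv inner_axis)
qed

lemma gradient_p: "gradient p x = g x"
  by (simp add: gradient_def partial_deriv_p)

lemma hessian_p: "hessian p x = H x"
proof -
  have "partial_deriv i (partial_deriv j p) x = H x $ i $ j" for i j
  proof -
    let ?e = "axis i 1 :: real^'n"
    have *: "partial_deriv j p = (\<lambda>x. g x $ j)"
      by (simp add: fun_eq_iff partial_deriv_p)
    have "((\<lambda>t. g (x + t *\<^sub>R ?e) $ j) has_field_derivative (H x *v ?e) $ j) (at 0)"
      unfolding g_add
      by (auto simp: M_linear mat_simps intro!: derivative_eq_intros)
    then have "partial_deriv i (partial_deriv j p) x = (H x *v ?e) $ j"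
      unfolding partial_deriv_def[of i] * by (rule DERIV_imp_deriv)
    \<comment> \<open>Differentiating component \<open>j\<close> of the gradient along axis
      \<open>i\<close> yields entry \<open>(j, i)\<close>; symmetry of \<open>H x\<close> restores
      the order of indices.\<close>
    also have "\<dots> = transpose (H x) $ i $ j"
      by (simp add: matrix_vector_mul_component inner_axis transpose_def)
    finally show ?thesis
      by (simp add: H_sym)
  qed
  then show ?thesis
    by (simp add: hessian_def vec_eq_iff)
qed

section \<open>Second-order points as constrained minimizers\<close>

lemma second_order_points_p: "second_order_points p = {x. g x = 0 \<and> pos_semidef (H x)}"
  by (simp add: second_order_points_def gradient_p hessian_p)

text \<open>Symmetry of the Hessian is automatic, so the set is cut out by the closed condition
  \<open>g x = 0\<close> and, for each fixed \<open>v\<close>, by an inequality that is affine in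
  \<open>x\<close>.\<close>

lemma closed_second_order_points: "closed (second_order_points p)"
proof -
  have bl: "bounded_bilinear (\<lambda>x y. M x *v y)"
    using M_bilinear by (simp add: bilinear_conv_bounded_bilinear)
  have Mc: "continuous_on UNIV (\<lambda>x. M x *v f x)" if "continuous_on UNIV f" for f
    using bounded_bilinear.continuous_on[OF bl continuous_on_id that] by simp
  have "second_order_points p = {x. g x = 0} \<inter> (\<Inter>v. {x. 0 \<le> v \<bullet> (H x *v v)})"
    by (auto simp: second_order_points_p pos_semidef_def H_sym)
  also have "closed \<dots>"
    unfolding g_def H_def mat_simps
    by (intro closed_Int closed_INT ballI closed_Collect_eq closed_Collect_le continuous_intros
        Mc matrix_vector_mult_linear_continuous_on)
  finally show ?thesis .
qed

text \<open>Replacing \<open>M d\<close> by \<open>H (x + d) - H x\<close> in Taylor's formula turns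
  the weights 1/2 and 1/6 into 1/2 - 1/6 = 1/3 and 1/6, so both remaining terms have the sign of a
  Hessian.\<close>

lemma p_add_second_order:
  assumes "g x = 0"
  shows "p (x + d) = p x + d \<bullet> (H x *v d) / 3 + d \<bullet> (H (x + d) *v d) / 6"
proof -
  have "d \<bullet> (H (x + d) *v d) = d \<bullet> (H x *v d) + d \<bullet> (M d *v d)"
    unfolding H_add mat_simps inner_add_right ..
  then show ?thesis
    unfolding p_add assms inner_zero_left by linarith
qed

lemma second_order_minimal:
  assumes "x \<in> second_order_points p" "pos_semidef (H y)"
  shows "p x \<le> p y"
proof -
  have "0 \<le> (y - x) \<bullet> (H x *v (y - x))" "0 \<le> (y - x) \<bullet> (H y *v (y - x))"
    using assms by (auto simp: second_order_points_p pos_semidef_def)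
  moreover have "g x = 0"
    using assms by (simp add: second_order_points_p)
  from p_add_second_order[OF this, of "y - x"]
  have "p y = p x + (y - x) \<bullet> (H x *v (y - x)) / 3 + (y - x) \<bullet> (H y *v (y - x)) / 6"
    by (simp only: add.commute[of x] diff_add_cancel)
  ultimately show ?thesis
    by linarith
qed

text \<open>Both Hessian terms in the Taylor formula are nonnegative, so equal values make both
  vanish. The two conclusions keep the gradient zero along the whole line through \<open>x\<close>
  and \<open>y\<close>.\<close>

lemma equal_value_kernel:
  assumes x: "x \<in> second_order_points p" and y: "pos_semidef (H y)" and le: "p y \<le> p x"
  shows "H x *v (y - x) = 0" and "M (y - x) *v (y - x) = 0"
proof -
  let ?d = "y - x"
  have Hx: "pos_semidef (H x)" and gx: "g x = 0"
    using x by (auto simp: second_order_points_p)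
  have "0 \<le> ?d \<bullet> (H x *v ?d)" "0 \<le> ?d \<bullet> (H y *v ?d)"
    using Hx y by (auto simp: pos_semidef_def)
  moreover have "p y = p x + ?d \<bullet> (H x *v ?d) / 3 + ?d \<bullet> (H y *v ?d) / 6"
    using p_add_second_order[OF gx, of ?d] by (simp only: add.commute[of x] diff_add_cancel)
  ultimately have "?d \<bullet> (H x *v ?d) = 0" "?d \<bullet> (H y *v ?d) = 0"
    using le by linarith+
  then have *: "H x *v ?d = 0" "H y *v ?d = 0"
    using Hx y pos_semidef_kernel by blast+
  then show "H x *v ?d = 0"
    by simp
  have "H y = H x + M ?d"
    using H_add[of x ?d] by simp
  with * show "M ?d *v ?d = 0"
    by (simp add: mat_simps)
qed

lemma second_order_eq_minimizers:
  assumes "second_order_points p \<noteq> {}"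
  shows "second_order_points p = minimizers_on p {x. pos_semidef (hessian p x)}"
proof (intro equalityI subsetI)
  fix x assume "x \<in> second_order_points p"
  then show "x \<in> minimizers_on p {x. pos_semidef (hessian p x)}"
    using second_order_minimal
    by (auto simp: minimizers_on_def hessian_p second_order_points_p)
next
  fix y assume "y \<in> minimizers_on p {x. pos_semidef (hessian p x)}"
  then have y: "pos_semidef (H y)" "\<And>z. pos_semidef (H z) \<Longrightarrow> p y \<le> p z"
    by (auto simp: minimizers_on_def hessian_p)
  from assms obtain x where x: "x \<in> second_order_points p"
    by blast
  then have "p y \<le> p x"
    using y(2) by (simp add: second_order_points_p)
  from equal_value_kernel[OF x y(1) this] have "g y = 0"
    using g_add[of x "y - x"] x by (simp add: second_order_points_p)
  then show "y \<in> second_order_points p"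
    using y(1) by (simp add: second_order_points_p)
qed

section \<open>Characterization of local minima\<close>

text \<open>On each line through \<open>x\<close>, the increment of \<open>p\<close> is a cubic in
  \<open>s\<close> that is nonnegative near 0; \<open>cubic_nonneg_near_0\<close> reads off its
  coefficients.\<close>

lemma local_minimum_imp:
  assumes x: "x \<in> local_minima p"
  shows "x \<in> second_order_points p"
    and "H x *v d = 0 \<Longrightarrow> d \<bullet> (M d *v d) = 0"
proof -
  from x obtain e where e: "e > 0" "\<And>y. norm (y - x) \<le> e \<Longrightarrow> p x \<le> p y"
    by (auto simp: local_minima_def)
  have ev: "\<forall>\<^sub>F s in nhds 0. 0 \<le> (g x \<bullet> d) * s + (d \<bullet> (H x *v d) / 2) * s^2
      + (d \<bullet> (M d *v d) / 6) * s^3" for d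
  proof -
    have "((\<lambda>s. norm (s *\<^sub>R d)) \<longlongrightarrow> norm (0 *\<^sub>R d)) (nhds 0)"
      by (intro tendsto_intros filterlim_ident)
    then have "\<forall>\<^sub>F s in nhds 0. norm (s *\<^sub>R d) < e"
      using e(1) by (intro order_tendstoD(2)) auto
    then show ?thesis
    proof eventually_elim
      case (elim s)
      then have "p x \<le> p (x + s *\<^sub>R d)"
        by (intro e(2)) simp
      then show ?case
        unfolding p_add
        by (simp add: M_linear mat_simps power2_eq_square power3_eq_cube algebra_simps)
    qed
  qed
  \<comment> \<open>In the direction \<open>g x\<close> the linear coefficient is the squared norm
    of the gradient.\<close>
  have "g x = 0"
    using cubic_nonneg_near_0(1)[OF ev[of "g x"]] by simp
  moreover have "pos_semidef (H x)"
    using cubic_nonneg_near_0(2)[OF ev] by (simp add: pos_semidef_def H_sym)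
  ultimately show "x \<in> second_order_points p"
    by (simp add: second_order_points_p)
  show "d \<bullet> (M d *v d) = 0" if "H x *v d = 0"
    using cubic_nonneg_near_0(3)[OF ev[of d]] unfolding that by simp
qed

text \<open>Along a kernel direction \<open>p\<close> is constant, so all points near a local minimum in this
  direction are local minima too; the condition is that the gradient vanishes there.\<close>

lemma local_minimum_kernel:
  assumes x: "x \<in> local_minima p" and d: "H x *v d = 0"
  shows "M d *v d = 0"
proof (cases "d = 0")
  case False
  from x obtain e where e: "e > 0" "\<And>y. norm (y - x) \<le> e \<Longrightarrow> p x \<le> p y"
    by (auto simp: local_minima_def)
  have gx: "g x = 0"
    using local_minimum_imp(1)[OF x] by (simp add: second_order_points_p)
  \<comment> \<open>The shift has length \<open>e / 2\<close>, so the ball of radius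
    \<open>e / 2\<close> around \<open>?z\<close> stays in the ball of radius \<open>e\<close>
    around \<open>x\<close>.\<close>
  define s where "s = e / (2 * norm d)"
  have s: "s > 0" "norm (s *\<^sub>R d) = e / 2"
    using e(1) False by (auto simp: s_def)
  let ?z = "x + s *\<^sub>R d"
  have pz: "p ?z = p x"
    using gx d local_minimum_imp(2)[OF x d]
    unfolding p_add by (simp add: M_linear mat_simps)
  have "?z \<in> local_minima p"
    unfolding local_minima_def
  proof (intro CollectI exI[of _ "e / 2"] conjI allI impI)
    fix y assume "norm (y - ?z) \<le> e / 2"
    then have "norm ((y - ?z) + s *\<^sub>R d) \<le> e / 2 + e / 2"
      using s(2) norm_triangle_mono by (metis order_refl)
    then show "p ?z \<le> p y"
      unfolding pz by (intro e(2)) simp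
  qed (use e in auto)
  then have "g ?z = 0"
    using local_minimum_imp(1) by (auto simp: second_order_points_p)
  \<comment> \<open>Here \<open>g_add\<close> leaves only \<open>s^2 / 2\<close> times
    \<open>M d *v d\<close>, and \<open>s > 0\<close>.\<close>
  then show ?thesis
    using gx d s(1) unfolding g_add by (simp add: M_linear mat_simps)
qed simp

text \<open>Split \<open>d\<close> into a kernel part \<open>w\<close> and an orthogonal part
  \<open>u\<close>. As \<open>M w *v w = 0\<close>, every surviving third-order term contains
  \<open>u\<close> twice, and for small \<open>d\<close> it is dominated by the coercive quadratic
  term in \<open>u\<close>.\<close>

lemma local_minimumI:
  assumes x: "x \<in> second_order_points p" and ker: "\<And>w. H x *v w = 0 \<Longrightarrow> M w *v w = 0"
  shows "x \<in> local_minima p"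
proof -
  have Hx: "pos_semidef (H x)" and gx: "g x = 0"
    using x by (auto simp: second_order_points_p)
  obtain l where l: "l > 0"
    "\<And>u. (\<And>w. H x *v w = 0 \<Longrightarrow> orthogonal u w) \<Longrightarrow> l * (norm u)^2 \<le> u \<bullet> (H x *v u)"
    using pos_semidef_coercive[OF Hx] by blast
  obtain K where K: "K > 0" "\<And>z u. norm (M z *v u) \<le> K * norm z * norm u"
    using bilinear_bounded_pos[OF M_bilinear] by blast
  \<comment> \<open>This radius bounds the third-order term by \<open>l * (norm u)^2 / 2\<close>,
    which half the quadratic form absorbs.\<close>
  have "p x \<le> p (x + d)" if d: "norm d \<le> l / (2 * K)" for d
  proof -
    let ?N = "{w. H x *v w = 0}"
    have sub: "subspace ?N"
      by (auto simp: subspace_def mat_simps)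
    obtain w u where "w \<in> span ?N" and orth: "\<And>v. v \<in> span ?N \<Longrightarrow> orthogonal u v"
      and dwu: "d = w + u"
      using orthogonal_subspace_decomp_exists[of ?N d] by metis
    then have Hw: "H x *v w = 0" and orth': "\<And>v. H x *v v = 0 \<Longrightarrow> orthogonal u v"
      using span_eq_iff[THEN iffD2, OF sub] by auto
    have uw: "u \<bullet> w = 0"
      using orth'[OF Hw] by (simp add: orthogonal_def)
    have "(norm d)^2 = (norm w)^2 + (norm u)^2"
      unfolding dwu power2_norm_eq_inner using uw by (simp add: inner_simps inner_commute)
    then have nu: "norm u \<le> norm d" and nw: "norm w \<le> norm d"
      by (simp_all add: power2_le_imp_le)
    \<comment> \<open>The third-order remainder
      \<open>(u \<bullet> (M u *v u) + 3 * (u \<bullet> (M w *v u))) / 6\<close> equals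
      \<open>u \<bullet> (M ?z *v u)\<close> by linearity of \<open>M\<close>.\<close>
    let ?z = "(1/6) *\<^sub>R u + (1/2) *\<^sub>R w"
    have Mww: "M w *v w = 0"
      using ker[OF Hw] .
    have "w \<bullet> (H x *v u) = 0" "w \<bullet> (M w *v u) = 0" "w \<bullet> (M u *v u) = u \<bullet> (M w *v u)"
      using symmetric_matrix_inner[OF H_sym, of w x u] M_inner[of w w u] M_inner'[of w u u] Hw Mww
      by simp_all
    note w = this
    have "d \<bullet> (H x *v d) = u \<bullet> (H x *v u)"
      unfolding dwu mat_simps inner_add_left by (simp add: Hw w)
    moreover have "d \<bullet> (M d *v d) = 3 * (u \<bullet> (M w *v u)) + u \<bullet> (M u *v u)"
      unfolding dwu M_linear mat_simps inner_add_left inner_add_right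
      by (simp add: M_commute[of u w] Mww w)
    moreover have "u \<bullet> (M ?z *v u) = u \<bullet> (M u *v u) / 6 + u \<bullet> (M w *v u) / 2"
      unfolding M_linear mat_simps inner_add_right inner_scaleR_right by simp
    ultimately have eq: "p (x + d) = p x + u \<bullet> (H x *v u) / 2 + u \<bullet> (M ?z *v u)"
      unfolding p_add gx inner_zero_left by linarith
    have "norm ?z \<le> norm u / 6 + norm w / 2"
      using norm_triangle_ineq[of "(1/6) *\<^sub>R u" "(1/2) *\<^sub>R w"] by simp
    also have "\<dots> \<le> norm d"
      using nu nw norm_ge_zero[of d] by linarith
    finally have nz: "norm ?z \<le> l / (2 * K)"
      using d by simp
    have "\<bar>u \<bullet> (M ?z *v u)\<bar> \<le> norm u * norm (M ?z *v u)"
      by (rule Cauchy_Schwarz_ineq2)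
    also have "\<dots> \<le> norm u * (K * (l / (2 * K)) * norm u)"
      using K nz by (intro mult_left_mono order_trans[OF K(2)] mult_right_mono) auto
    also have "\<dots> = l * (norm u)^2 / 2"
      using K(1) by (simp add: power2_eq_square)
    finally have "\<bar>u \<bullet> (M ?z *v u)\<bar> \<le> l * (norm u)^2 / 2" .
    moreover have "l * (norm u)^2 \<le> u \<bullet> (H x *v u)"
      using orth' by (rule l(2))
    ultimately show ?thesis
      unfolding eq by linarith
  qed
  from this[of "y - x" for y] have "\<forall>y. norm (y - x) \<le> l / (2 * K) \<longrightarrow> p x \<le> p y"
    by simp
  moreover have "l / (2 * K) > 0"
    using l(1) K(1) by simp
  ultimately show ?thesis
    unfolding local_minima_def by blast
qed

section \<open>Density of the local minima in the second-order points\<close>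

text \<open>\<open>H\<close> is affine, so its value at the point is a convex combination of
  \<open>H x\<close> and \<open>H y\<close>. The weight \<open>1 - t > 0\<close> forces a kernel
  vector into the kernel of \<open>H x\<close>, where the local minimum \<open>x\<close> controls
  \<open>M\<close>.\<close>

lemma segment_local_minimum:
  assumes x: "x \<in> local_minima p" and y: "y \<in> second_order_points p" and t: "0 \<le> t" "t < 1"
  shows "x + t *\<^sub>R (y - x) \<in> local_minima p"
proof -
  let ?d = "y - x"
  let ?z = "x + t *\<^sub>R ?d"
  have xs: "x \<in> second_order_points p"
    by (rule local_minimum_imp(1)[OF x])
  then have gx: "g x = 0" and Hx: "pos_semidef (H x)" and Hy: "pos_semidef (H y)"
    using y by (auto simp: second_order_points_p)
  \<comment> \<open>\<open>x\<close> is feasible for the constrained problem that \<open>y\<close>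
    solves.\<close>
  have "p y \<le> p x"
    using second_order_minimal[OF y Hx] .
  note ker = equal_value_kernel[OF xs Hy this]
  have Hz: "H ?z = (1 - t) *\<^sub>R H x + t *\<^sub>R H y"
    by (simp add: H_def M_linear algebra_simps)
  have quad: "v \<bullet> (H ?z *v v) = (1 - t) * (v \<bullet> (H x *v v)) + t * (v \<bullet> (H y *v v))" for v
    unfolding Hz by (simp add: mat_simps inner_simps)
  have nonneg: "0 \<le> v \<bullet> (H x *v v)" "0 \<le> v \<bullet> (H y *v v)" for v
    using Hx Hy by (auto simp: pos_semidef_def)
  have "g ?z = 0"
    using gx ker by (simp add: g_add M_linear mat_simps)
  moreover have "pos_semidef (H ?z)"
    using quad nonneg t by (simp add: pos_semidef_def H_sym)
  ultimately have "?z \<in> second_order_points p"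
    by (simp add: second_order_points_p)
  then show ?thesis
  proof (rule local_minimumI)
    fix w assume "H ?z *v w = 0"
    then have "(1 - t) * (w \<bullet> (H x *v w)) + t * (w \<bullet> (H y *v w)) = 0"
      using quad[of w] by simp
    moreover have "0 \<le> (1 - t) * (w \<bullet> (H x *v w))" "0 \<le> t * (w \<bullet> (H y *v w))"
      using nonneg t by auto
    ultimately have "(1 - t) * (w \<bullet> (H x *v w)) = 0"
      by linarith
    then have "w \<bullet> (H x *v w) = 0"
      using t by simp
    then show "M w *v w = 0"
      using local_minimum_kernel[OF x] pos_semidef_kernel[OF Hx] by blast
  qed
qed

lemma second_order_eq_closure:
  assumes "local_minima p \<noteq> {}"
  shows "second_order_points p = closure (local_minima p)"
proof
  show "closure (local_minima p) \<subseteq> second_order_points p"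
    using local_minimum_imp(1) by (intro closure_minimal closed_second_order_points) blast
  show "second_order_points p \<subseteq> closure (local_minima p)"
  proof
    fix y assume y: "y \<in> second_order_points p"
    from assms obtain x where x: "x \<in> local_minima p"
      by blast
    \<comment> \<open>The index \<open>Suc n\<close> keeps the parameter below 1 also for
      \<open>n = 0\<close>, where division by zero would give 1.\<close>
    let ?t = "\<lambda>n. 1 - 1 / real (Suc n)"
    have "(\<lambda>n. x + ?t n *\<^sub>R (y - x)) \<longlonglongrightarrow> x + (1 - 0) *\<^sub>R (y - x)"
      by (intro tendsto_intros LIMSEQ_Suc lim_1_over_n)
    moreover have "x + ?t n *\<^sub>R (y - x) \<in> local_minima p" for n
      by (rule segment_local_minimum[OF x y]) auto
    ultimately show "y \<in> closure (local_minima p)"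
      unfolding closure_sequential by (auto intro!: exI[of _ "\<lambda>n. x + ?t n *\<^sub>R (y - x)"])
  qed
qed

end

section \<open>Every cubic polynomial has such an expansion\<close>

text \<open>Hiding the data allows closure under sums and multiples to be applied without computing
  coefficients.\<close>

definition has_cubic_expansion :: "(real^'n::finite \<Rightarrow> real) \<Rightarrow> bool" where
  "has_cubic_expansion p \<longleftrightarrow> (\<exists>c b B M. cubic_expansion p c b B M)"

definition outer :: "real^'n::finite \<Rightarrow> real^'n \<Rightarrow> real^'n^'n" where
  "outer u v = (\<chi> i j. u $ i * v $ j)"

lemma outer_mult: "outer u v *v x = (v \<bullet> x) *\<^sub>R u"
  by (simp add: outer_def matrix_vector_mult_def inner_vec_def vec_eq_iff sum_distrib_left mult_ac)

lemma transpose_outer: "transpose (outer u v) = outer v u"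
  by (simp add: outer_def transpose_def vec_eq_iff mult.commute)

lemma transpose_add: "transpose (A + B) = transpose A + transpose (B :: real^'n::finite^'n)"
  by (simp add: transpose_def vec_eq_iff)

lemma transpose_scaleR: "transpose (k *\<^sub>R A) = k *\<^sub>R transpose (A :: real^'n::finite^'n)"
  by (simp add: transpose_def vec_eq_iff)

lemma transpose_zero: "transpose 0 = (0 :: real^'n::finite^'n)"
  by (simp add: transpose_def vec_eq_iff)

lemma has_cubic_expansion_const: "has_cubic_expansion (\<lambda>x. k)"
proof -
  have "cubic_expansion (\<lambda>x. k) k 0 0 (\<lambda>x. 0)"
    by unfold_locales (auto simp: transpose_zero linear_zero)
  then show ?thesis
    unfolding has_cubic_expansion_def by blast
qed

lemma has_cubic_expansion_linear: "has_cubic_expansion (\<lambda>x. u \<bullet> x)"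
proof -
  have "cubic_expansion (\<lambda>x. u \<bullet> x) 0 u 0 (\<lambda>x. 0)"
    by unfold_locales (auto simp: transpose_zero linear_zero)
  then show ?thesis
    unfolding has_cubic_expansion_def by blast
qed

lemma has_cubic_expansion_mult2: "has_cubic_expansion (\<lambda>x. (u \<bullet> x) * (v \<bullet> x))"
proof -
  have "cubic_expansion (\<lambda>x. (u \<bullet> x) * (v \<bullet> x)) 0 0 (outer u v + outer v u) (\<lambda>x. 0)"
    by unfold_locales
      (auto simp: transpose_zero transpose_add transpose_outer linear_zero add.commute outer_mult
        matrix_vector_mult_add_rdistrib inner_simps inner_commute)
  then show ?thesis
    unfolding has_cubic_expansion_def by blast
qed

text \<open>The witness for \<open>M\<close> symmetrizes the product over the six orderings of
  \<open>u\<close>, \<open>v\<close>, \<open>w\<close>, which cancels the factor 1/6.\<close>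

lemma has_cubic_expansion_mult3: "has_cubic_expansion (\<lambda>x. (u \<bullet> x) * ((v \<bullet> x) * (w \<bullet> x)))"
proof -
  have "cubic_expansion (\<lambda>x. (u \<bullet> x) * ((v \<bullet> x) * (w \<bullet> x))) 0 0 0
    (\<lambda>x. (u \<bullet> x) *\<^sub>R (outer v w + outer w v) + (v \<bullet> x) *\<^sub>R (outer u w + outer w u)
        + (w \<bullet> x) *\<^sub>R (outer u v + outer v u))"
  proof (rule cubic_expansion.intro)
    show "linear (\<lambda>x. (u \<bullet> x) *\<^sub>R (outer v w + outer w v) + (v \<bullet> x) *\<^sub>R (outer u w + outer w u)
        + (w \<bullet> x) *\<^sub>R (outer u v + outer v u))"
      by (rule linearI) (simp_all add: inner_simps algebra_simps)
  qed (unfold matrix_vector_mult_add_rdistrib scaleR_matrix_vector_assoc[symmetric] outer_mult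
        inner_add_right inner_scaleR_right,
      simp_all add: transpose_zero transpose_add transpose_scaleR transpose_outer inner_commute
        scaleR_add_right distrib_left add_ac mult_ac)
  then show ?thesis
    unfolding has_cubic_expansion_def by blast
qed

lemma has_cubic_expansion_add:
  assumes "has_cubic_expansion p" "has_cubic_expansion q"
  shows "has_cubic_expansion (\<lambda>x. p x + q x)"
proof -
  obtain c b B M c' b' B' M' where "cubic_expansion p c b B M" "cubic_expansion q c' b' B' M'"
    using assms unfolding has_cubic_expansion_def by blast
  then have "cubic_expansion (\<lambda>x. p x + q x) (c + c') (b + b') (B + B') (\<lambda>x. M x + M' x)"
    unfolding cubic_expansion_def
    by (auto simp: linear_compose_add transpose_add matrix_vector_mult_add_rdistrib inner_simps
        add_divide_distrib)
  then show ?thesis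
    unfolding has_cubic_expansion_def by blast
qed

lemma has_cubic_expansion_cmult:
  assumes "has_cubic_expansion p"
  shows "has_cubic_expansion (\<lambda>x. k * p x)"
proof -
  obtain c b B M where "cubic_expansion p c b B M"
    using assms unfolding has_cubic_expansion_def by blast
  then have "cubic_expansion (\<lambda>x. k * p x) (k * c) (k *\<^sub>R b) (k *\<^sub>R B) (\<lambda>x. k *\<^sub>R M x)"
    unfolding cubic_expansion_def
    by (auto simp: linear_compose_scale_right transpose_scaleR
        scaleR_matrix_vector_assoc[symmetric] inner_simps algebra_simps)
  then show ?thesis
    unfolding has_cubic_expansion_def by blast
qed

lemma has_cubic_expansion_sum:
  assumes "finite A" "\<And>a. a \<in> A \<Longrightarrow> has_cubic_expansion (f a)"
  shows "has_cubic_expansion (\<lambda>x. \<Sum>a\<in>A. f a x)"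
  using assms
  by (induction A rule: finite_induct)
    (auto intro: has_cubic_expansion_add has_cubic_expansion_const)

text \<open>Listing variables with multiplicity turns the degree bound into a length bound, leaving
  four shapes of products of linear forms. The induction on the degree splits off one variable at a
  time.\<close>

lemma monomial_eq_prod_list:
  fixes \<alpha> :: "'n::finite \<Rightarrow> nat"
  shows "\<exists>is. length is = (\<Sum>i\<in>UNIV. \<alpha> i) \<and>
    (\<forall>x :: real^'n. (\<Prod>i\<in>UNIV. (x $ i) ^ \<alpha> i) = prod_list (map (\<lambda>i. axis i 1 \<bullet> x) is))"
proof (induction "\<Sum>i\<in>UNIV. \<alpha> i" arbitrary: \<alpha>)
  case 0
  then show ?case
    by (auto intro!: exI[of _ "[]"])
next
  case (Suc n)
  then obtain j k where j: "\<alpha> j = Suc k"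
    by (metis nat.distinct(1) not0_implies_Suc sum.neutral)
  define \<beta> where "\<beta> = \<alpha>(j := k)"
  have "(\<Sum>i\<in>UNIV. \<alpha> i) = Suc (\<Sum>i\<in>UNIV. \<beta> i)"
    using j by (simp add: \<beta>_def sum.remove[of UNIV j])
  with Suc.hyps(2) have "n = (\<Sum>i\<in>UNIV. \<beta> i)"
    by simp
  from Suc.hyps(1)[OF this] obtain "is" where "is": "length is = (\<Sum>i\<in>UNIV. \<beta> i) \<and>
    (\<forall>x :: real^'n. (\<Prod>i\<in>UNIV. (x $ i) ^ \<beta> i) = prod_list (map (\<lambda>i. axis i 1 \<bullet> x) is))"
    by (rule exE)
  have "(\<Prod>i\<in>UNIV. (x $ i) ^ \<alpha> i) = x $ j * (\<Prod>i\<in>UNIV. (x $ i) ^ \<beta> i)" for x :: "real^'n"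
    using j by (simp add: \<beta>_def prod.remove[of UNIV j])
  then show ?case
    using "is" \<open>(\<Sum>i\<in>UNIV. \<alpha> i) = _\<close> by (auto intro!: exI[of _ "j # is"] simp: inner_axis')
qed

text \<open>Lengths 0 to 3 match the four building blocks; \<open>prod_list\<close> nests to the
  right, as does the triple product in \<open>has_cubic_expansion_mult3\<close>.\<close>

lemma has_cubic_expansion_prod_list:
  assumes "length is \<le> 3"
  shows "has_cubic_expansion (\<lambda>x. prod_list (map (\<lambda>i. axis i 1 \<bullet> x) is))"
proof -
  consider "is = []" | i where "is = [i]" | i j where "is = [i, j]" | i j k where "is = [i, j, k]"
    using assms by (auto simp: numeral_eq_Suc le_Suc_eq length_Suc_conv)
  then show ?thesis
    by cases (auto simp: has_cubic_expansion_const has_cubic_expansion_linear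
        has_cubic_expansion_mult2 has_cubic_expansion_mult3)
qed

lemma cubic_polynomial_has_expansion:
  assumes "cubic_polynomial p"
  shows "has_cubic_expansion p"
proof -
  obtain c where p: "p = (\<lambda>x. \<Sum>\<alpha> | (\<Sum>i\<in>UNIV. \<alpha> i) \<le> 3. c \<alpha> * (\<Prod>i\<in>UNIV. (x $ i) ^ \<alpha> i))"
    using assms unfolding cubic_polynomial_def fun_eq_iff by blast
  show ?thesis
    unfolding p
  proof (intro has_cubic_expansion_sum finite_exponents_degree_le has_cubic_expansion_cmult)
    fix \<alpha> :: "'a \<Rightarrow> nat" assume "\<alpha> \<in> {\<alpha>. (\<Sum>i\<in>UNIV. \<alpha> i) \<le> 3}"
    with monomial_eq_prod_list[of \<alpha>] obtain "is" where "length is \<le> 3"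
      "\<And>x :: real^'a. (\<Prod>i\<in>UNIV. (x $ i) ^ \<alpha> i) = prod_list (map (\<lambda>i. axis i 1 \<bullet> x) is)"
      by force
    then show "has_cubic_expansion (\<lambda>x. \<Prod>i\<in>UNIV. (x $ i) ^ \<alpha> i)"
      using has_cubic_expansion_prod_list by simp
  qed
qed

theorem theorem4p7:
  fixes p :: "real^'n::finite \<Rightarrow> real"
  assumes "cubic_polynomial p"
    and "second_order_points p \<noteq> {}"
  shows "second_order_points p = minimizers_on p {x. pos_semidef (hessian p x)}
    \<and> (local_minima p \<noteq> {} \<longrightarrow>
          second_order_points p = closure (local_minima p)
        \<and> minimizers_on p {x. pos_semidef (hessian p x)} = closure (local_minima p))"
proof -
  obtain c b B M where "cubic_expansion p c b B M"
    using cubic_polynomial_has_expansion[OF assms(1)] unfolding has_cubic_expansion_def by blast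
  then interpret cubic_expansion p c b B M .
  show ?thesis
    using second_order_eq_minimizers[OF assms(2)] second_order_eq_closure by simp
qed

end
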